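(* There is a universal constant $C>0$ such that the following holds. Let $n\ge4$, let $g_Y(y_1,y_2)$ and $g_Z(z_1,z_2)$ be real-valued functions symmetric in their arguments, let $\mathcal{X}_n=((Y_1,Z_1),\dots,(Y_n,Z_n))$ be the (conditioned upon, hence fixed) sample, and let $\pi$ be uniformly distributed on the set $\mathbf{\Pi}_n$ of permutations of $\{1,\dots,n\}$. Let $U_n^\pi$ be the permuted $U$-statistic for independence testing and define $$\Sigma_n^2:=\frac{1}{n^2(n-1)^2}\ \sup_{\pi\in\mathbf{\Pi}_n}\left\{\sum_{1\le i_1\ne i_2\le n}g_Y^2(Y_{i_1},Y_{i_2})\,g_Z^2(Z_{\pi_{i_1}},Z_{\pi_{i_2}})\right\}.$$ Then for every $t>0$, $$\mathbb{P}_\pi\big(U_n^\pi\ge t\mid\mathcal{X}_n\big)\le\exp\left\{-C\min\left(\frac{t^2}{\Sigma_n^2},\ \frac{t}{\Sigma_n}\right)\right\}.$$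
   Context: For $x_i=(y_i,z_i)$ let $$h_{\rm in}(x_1,x_2,x_3,x_4):=\{g_Y(y_1,y_2)+g_Y(y_3,y_4)-g_Y(y_1,y_3)-g_Y(y_2,y_4)\}\cdot\{g_Z(z_1,z_2)+g_Z(z_3,z_4)-g_Z(z_1,z_3)-g_Z(z_2,z_4)\}.$$ The permuted statistic is $$U_n^\pi:=\frac{1}{n(n-1)(n-2)(n-3)}\sum h_{\rm in}\{(Y_{i_1},Z_{\pi_{i_1}}),(Y_{i_2},Z_{\pi_{i_2}}),(Y_{i_3},Z_{\pi_{i_3}}),(Y_{i_4},Z_{\pi_{i_4}})\},$$ sum over all ordered 4-tuples $(i_1,i_2,i_3,i_4)$ of distinct indices in $\{1,\dots,n\}$. $\mathbb{P}_\pi(\cdot\mid\mathcal{X}_n)$ is the probability over $\pi$ only. When $\Sigma_n=0$ the right-hand side is read as $0$. *)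

theory Defs
  imports "HOL-Probability.Probability" "HOL-Combinatorics.Permutations"
begin

definition h_in ::
  "('a \<Rightarrow> 'a \<Rightarrow> real) \<Rightarrow> ('b \<Rightarrow> 'b \<Rightarrow> real) \<Rightarrow>
   'a \<times> 'b \<Rightarrow> 'a \<times> 'b \<Rightarrow> 'a \<times> 'b \<Rightarrow> 'a \<times> 'b \<Rightarrow> real"
where
  "h_in gY gZ x1 x2 x3 x4 =
     (gY (fst x1) (fst x2) + gY (fst x3) (fst x4) - gY (fst x1) (fst x3) - gY (fst x2) (fst x4)) *
     (gZ (snd x1) (snd x2) + gZ (snd x3) (snd x4) - gZ (snd x1) (snd x3) - gZ (snd x2) (snd x4))"

text \<open>The sample is given by sequences \<open>Y\<close> and \<open>Z\<close>, of which only the values at the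
  indices \<open>1, \<dots>, n\<close> are used.\<close>

definition U_perm ::
  "nat \<Rightarrow> ('a \<Rightarrow> 'a \<Rightarrow> real) \<Rightarrow> ('b \<Rightarrow> 'b \<Rightarrow> real) \<Rightarrow>
   (nat \<Rightarrow> 'a) \<Rightarrow> (nat \<Rightarrow> 'b) \<Rightarrow> (nat \<Rightarrow> nat) \<Rightarrow> real"
where
  "U_perm n gY gZ Y Z p =
     1 / (real n * (real n - 1) * (real n - 2) * (real n - 3)) *
     (\<Sum>(i1, i2, i3, i4) \<in> {(i1, i2, i3, i4). {i1, i2, i3, i4} \<subseteq> {1..n} \<and> distinct [i1, i2, i3, i4]}.
        h_in gY gZ (Y i1, Z (p i1)) (Y i2, Z (p i2)) (Y i3, Z (p i3)) (Y i4, Z (p i4)))"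

definition Sigma_n ::
  "nat \<Rightarrow> ('a \<Rightarrow> 'a \<Rightarrow> real) \<Rightarrow> ('b \<Rightarrow> 'b \<Rightarrow> real) \<Rightarrow> (nat \<Rightarrow> 'a) \<Rightarrow> (nat \<Rightarrow> 'b) \<Rightarrow> real"
where
  "Sigma_n n gY gZ Y Z = sqrt
     (1 / ((real n)\<^sup>2 * (real n - 1)\<^sup>2) *
      (SUP p \<in> {p. p permutes {1..n}}.
         \<Sum>(i1, i2) \<in> {(i1, i2). i1 \<in> {1..n} \<and> i2 \<in> {1..n} \<and> i1 \<noteq> i2}.
           (gY (Y i1) (Y i2))\<^sup>2 * (gZ (Z (p i1)) (Z (p i2)))\<^sup>2))"

text \<open>In the degenerate case \<open>s = 0\<close> the bound is \<open>0\<close>, the limit for \<open>s\<close> tending to \<open>0\<close>;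
  the convention \<open>x / 0 = 0\<close> would give the vacuous bound \<open>1\<close> instead.\<close>

definition exp_tail :: "real \<Rightarrow> real \<Rightarrow> real \<Rightarrow> real"
where
  "exp_tail C s t = (if s = 0 then 0 else exp (- C * min (t\<^sup>2 / s\<^sup>2) (t / s)))"

text \<open>The tail bound with the constant \<open>C\<close> for all sample sizes, kernels and samples with values in
  the types \<open>'a\<close> and \<open>'b\<close>. The two type arguments make it possible to say
  that \<open>C\<close> does not depend on the spaces in which the observations live.\<close>

definition perm_tail_bound :: "'a itself \<Rightarrow> 'b itself \<Rightarrow> real \<Rightarrow> bool"
where
  "perm_tail_bound (_ :: 'a itself) (_ :: 'b itself) C \<longleftrightarrow>
     (\<forall>n\<ge>4. \<forall>(gY :: 'a \<Rightarrow> 'a \<Rightarrow> real) (gZ :: 'b \<Rightarrow> 'b \<Rightarrow> real) (Y :: nat \<Rightarrow> 'a) (Z :: nat \<Rightarrow> 'b).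
        (\<forall>y1 y2. gY y1 y2 = gY y2 y1) \<longrightarrow>
        (\<forall>z1 z2. gZ z1 z2 = gZ z2 z1) \<longrightarrow>
        (\<forall>t>0. measure_pmf.prob (pmf_of_set {p. p permutes {1..n}}) {p. U_perm n gY gZ Y Z p \<ge> t}
                 \<le> exp_tail C (Sigma_n n gY gZ Y Z) t))"

text \<open>Type variables are quantified outside the whole proposition, so
  \<^term>\<open>\<exists>C>0. perm_tail_bound TYPE('a) TYPE('b) C\<close> alone would let \<open>C\<close> depend on \<open>'a\<close> and \<open>'b\<close>.
  Universality of \<open>C\<close> is expressed by adding that every \<open>C\<close> that works for \<open>nat\<close>-valued samples
  works for \<open>'a\<close> and \<open>'b\<close>: instantiating \<open>'a\<close> and \<open>'b\<close> to \<open>nat\<close> in the existence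
  statement then yields a single \<open>C\<close> for all types.\<close>

end

theory Submission
  imports Defs "HOL-Probability.Hoeffding"
begin

text \<open>The chaos argument behind the tail bound: \<open>h_in\<close> is antisymmetric under \<open>i1 \<leftrightarrow> i4\<close> and under
  \<open>i2 \<leftrightarrow> i3\<close>. With \<open>m = n div 2\<close>, the statistic \<open>U\<^sub>n\<^sup>\<pi>\<close> is the average over all permutations \<open>\<tau>\<close> of the
  normalised sum over \<open>k \<noteq> l \<le> m\<close> of \<open>h_in\<close> at the indices \<open>\<tau> k, \<tau> l, \<tau> (m + l), \<tau> (m + k)\<close>, so by
  Jensen's inequality it suffices to bound the exponential moment of that sum with
  \<open>\<rho> = \<pi> \<circ> \<tau>\<close> independent of \<open>\<tau>\<close>. The law of \<open>\<rho>\<close> is invariant under random swaps \<open>k \<leftrightarrow> m + k\<close> of its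
  arguments, which multiply the \<open>(k, l)\<close> term by the product of two random signs. What remains is a
  Rademacher chaos whose squared Frobenius norm is at most a multiple of \<open>\<Sigma>\<^sub>n\<^sup>2\<close>, and Chernoff's bound
  finishes the proof.\<close>

section \<open>Exponential moments of a Rademacher chaos\<close>

text \<open>The sub-Gaussian estimate for one random sign. For a nonnegative argument
  \<open>y\<close> it comes from the logarithmic inequality behind Hoeffding's lemma, at
  \<open>2 * y\<close> and probability 1/2; both sides are even, which covers the rest.\<close>

lemma exp_plus_exp_minus_le:
  fixes x :: real
  shows "exp x + exp (- x) \<le> 2 * exp (x\<^sup>2 / 2)"
proof -
  have nonneg: "exp y + exp (- y) \<le> 2 * exp (y\<^sup>2 / 2)" if "y \<ge> 0" for y :: real
  proof -
    have "- (2 * y) * (1/2) + ln (1 + (1/2) * (exp (2 * y) - 1)) \<le> (2 * y)\<^sup>2 / 8"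
      using Hoeffdings_lemma_aux[of "2 * y" "1/2"] that by simp
    hence "ln ((1 + exp (2 * y)) / 2) \<le> y + y\<^sup>2 / 2"
      by (simp add: field_simps power2_eq_square)
    moreover have pos: "(1 + exp (2 * y)) / 2 > 0" by (simp add: add_pos_pos)
    ultimately have "(1 + exp (2 * y)) / 2 \<le> exp (y + y\<^sup>2 / 2)"
      by (metis exp_le_cancel_iff exp_ln)
    hence "(1 + exp (2 * y)) \<le> 2 * exp (y + y\<^sup>2 / 2)" by simp
    hence "exp (- y) * (1 + exp (2 * y)) \<le> exp (- y) * (2 * exp (y + y\<^sup>2 / 2))"
      by (intro mult_left_mono) auto
    moreover have "exp (- y) * exp (2 * y) = exp y" "exp (- y) * exp (y + y\<^sup>2 / 2) = exp (y\<^sup>2 / 2)"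
      by (simp_all flip: exp_add)
    ultimately show ?thesis by (simp add: algebra_simps)
  qed
  show ?thesis using nonneg[of x] nonneg[of "- x"] by (cases "x \<ge> 0") auto
qed

text \<open>Rademacher signs are encoded by the set \<open>T\<close> of indices with sign -1, so
  expectations over signs become sums over \<open>Pow I\<close>. The same \<open>T\<close> later
  selects the pairs exchanged by \<open>half_swap\<close>.\<close>

definition flip :: "'i set \<Rightarrow> 'i \<Rightarrow> real" where
  "flip T i = (if i \<in> T then - 1 else 1)"

lemma flip_square: "flip T i * flip T i = 1"
  by (simp add: flip_def)

definition chaos :: "'i set \<Rightarrow> ('i \<Rightarrow> 'i \<Rightarrow> real) \<Rightarrow> 'i set \<Rightarrow> real" where
  "chaos I A T = (\<Sum>j\<in>I. \<Sum>k\<in>I. A j k * (flip T j * flip T k))"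

lemma sum_Pow_insert:
  assumes "finite I" "i \<notin> I"
  shows "(\<Sum>T\<in>Pow (insert i I). f T) = (\<Sum>T\<in>Pow I. f T + f (insert i T))"
proof -
  have inj: "inj_on (insert i) (Pow I)"
    using assms by (intro inj_onI) (metis PowD insert_ident subsetD)
  have "(\<Sum>T\<in>Pow (insert i I). f T) = (\<Sum>T\<in>Pow I. f T) + (\<Sum>T\<in>insert i ` Pow I. f T)"
    unfolding Pow_insert using assms by (intro sum.union_disjoint) auto
  thus ?thesis by (simp add: sum.reindex[OF inj] sum.distrib)
qed

text \<open>By symmetry the row and the column of \<open>i\<close> contribute equally, and the
  diagonal entry vanishes, so the chaos is affine in the sign of \<open>i\<close>.\<close>

lemma chaos_insert:
  assumes "finite I" "i \<notin> I" "A i i = 0" and sym: "\<And>j k. A j k = A k j"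
  shows "chaos (insert i I) A T = chaos I A T + 2 * (flip T i * (\<Sum>j\<in>I. A i j * flip T j))"
proof -
  have "chaos (insert i I) A T =
    (\<Sum>k\<in>I. A i k * (flip T i * flip T k)) + ((\<Sum>j\<in>I. A j i * (flip T j * flip T i)) + chaos I A T)"
    using assms(1-3) by (simp add: chaos_def sum.distrib)
  also have "(\<Sum>j\<in>I. A j i * (flip T j * flip T i)) = (\<Sum>k\<in>I. A i k * (flip T i * flip T k))"
    by (intro sum.cong refl) (simp add: sym[of _ i])
  also have "(\<Sum>k\<in>I. A i k * (flip T i * flip T k)) = flip T i * (\<Sum>k\<in>I. A i k * flip T k)"
    by (simp add: sum_distrib_left mult_ac)
  finally show ?thesis by simp
qed

text \<open>Signs square to 1, so the diagonal of the squared linear form is a constant; only its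
  off-diagonal part has to be merged into the coefficients, which keeps their diagonal zero.\<close>

lemma chaos_rank_one:
  assumes "finite I" "\<And>j. A j j = 0"
  shows "chaos I A T + 2 * (\<Sum>j\<in>I. a j * flip T j)\<^sup>2 =
    2 * (\<Sum>j\<in>I. (a j)\<^sup>2) + chaos I (\<lambda>j k. if j = k then 0 else A j k + 2 * (a j * a k)) T"
proof -
  have "2 * (\<Sum>j\<in>I. a j * flip T j)\<^sup>2 = (\<Sum>j\<in>I. \<Sum>k\<in>I. 2 * (a j * a k) * (flip T j * flip T k))"
    unfolding power2_eq_square sum_product by (simp add: sum_distrib_left mult_ac)
  moreover have "(\<Sum>k\<in>I. A j k * (flip T j * flip T k)) +
      (\<Sum>k\<in>I. 2 * (a j * a k) * (flip T j * flip T k)) = 2 * (a j)\<^sup>2 +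
      (\<Sum>k\<in>I. (if j = k then 0 else A j k + 2 * (a j * a k)) * (flip T j * flip T k))"
    if "j \<in> I" for j
  proof -
    have "(\<Sum>k\<in>I. A j k * (flip T j * flip T k)) +
        (\<Sum>k\<in>I. 2 * (a j * a k) * (flip T j * flip T k)) =
       (\<Sum>k\<in>I. (if k = j then 2 * (a j)\<^sup>2 else 0) +
          (if j = k then 0 else A j k + 2 * (a j * a k)) * (flip T j * flip T k))"
      unfolding sum.distrib[symmetric] using assms(2)
      by (intro sum.cong refl) (auto simp: flip_square power2_eq_square algebra_simps)
    also have "\<dots> = 2 * (a j)\<^sup>2 +
      (\<Sum>k\<in>I. (if j = k then 0 else A j k + 2 * (a j * a k)) * (flip T j * flip T k))"
      using that assms(1) by (simp add: sum.distrib)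
    finally show ?thesis .
  qed
  ultimately show ?thesis
    unfolding chaos_def by (simp add: sum.distrib[symmetric] sum_distrib_left)
qed

text \<open>Triangle inequality for the Frobenius norm: \<open>r\<close> is the norm of
  \<open>A\<close>, \<open>s\<close> that of the rank-one matrix, and Cauchy-Schwarz bounds their
  inner product. Zeroing the diagonal only decreases the norm.\<close>

lemma frobenius_rank_one_le:
  fixes A :: "'i \<Rightarrow> 'i \<Rightarrow> real"
  assumes r: "(\<Sum>j\<in>I. \<Sum>k\<in>I. (A j k)\<^sup>2) = r\<^sup>2" "r \<ge> 0" and s: "s = (\<Sum>j\<in>I. (a j)\<^sup>2)"
  shows "(\<Sum>j\<in>I. \<Sum>k\<in>I. (if j = k then 0 else A j k + 2 * (a j * a k))\<^sup>2) \<le> (r + 2 * s)\<^sup>2"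
proof -
  have aa: "(\<Sum>j\<in>I. \<Sum>k\<in>I. (a j * a k)\<^sup>2) = s\<^sup>2"
    unfolding s power2_eq_square sum_product by (simp add: mult_ac)
  have s0: "s \<ge> 0" unfolding s by (intro sum_nonneg) auto
  have "(\<Sum>x\<in>I\<times>I. A (fst x) (snd x) * (a (fst x) * a (snd x)))\<^sup>2 \<le>
      (\<Sum>x\<in>I\<times>I. (A (fst x) (snd x))\<^sup>2) * (\<Sum>x\<in>I\<times>I. (a (fst x) * a (snd x))\<^sup>2)"
    by (rule Cauchy_Schwarz_ineq_sum)
  hence "(\<Sum>j\<in>I. \<Sum>k\<in>I. A j k * (a j * a k))\<^sup>2 \<le> (r * s)\<^sup>2"
    by (simp only: sum.cartesian_product' fst_conv snd_conv aa r power_mult_distrib[of r s])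
  hence cs: "(\<Sum>j\<in>I. \<Sum>k\<in>I. A j k * (a j * a k)) \<le> r * s"
    by (rule power2_le_imp_le) (use r s0 in simp)
  have "(\<Sum>j\<in>I. \<Sum>k\<in>I. (if j = k then 0 else A j k + 2 * (a j * a k))\<^sup>2) \<le>
      (\<Sum>j\<in>I. \<Sum>k\<in>I. (A j k)\<^sup>2 + (4 * (A j k * (a j * a k)) + 4 * (a j * a k)\<^sup>2))"
  proof (intro sum_mono)
    fix j k
    have "(A j k)\<^sup>2 + (4 * (A j k * (a j * a k)) + 4 * (a j * a k)\<^sup>2) = (A j k + 2 * (a j * a k))\<^sup>2"
      by (simp add: power2_eq_square algebra_simps)
    thus "(if j = k then 0 else A j k + 2 * (a j * a k))\<^sup>2 \<le>
        (A j k)\<^sup>2 + (4 * (A j k * (a j * a k)) + 4 * (a j * a k)\<^sup>2)" by simp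
  qed
  also have "\<dots> = r\<^sup>2 + (4 * (\<Sum>j\<in>I. \<Sum>k\<in>I. A j k * (a j * a k)) + 4 * s\<^sup>2)"
    by (simp add: sum.distrib r aa flip: sum_distrib_left)
  also have "\<dots> \<le> r\<^sup>2 + (4 * (r * s) + 4 * s\<^sup>2)" using cs by simp
  also have "\<dots> = (r + 2 * s)\<^sup>2" by (simp add: power2_eq_square algebra_simps)
  finally show ?thesis .
qed

text \<open>Averaging out the sign of the new index turns its row \<open>a\<close> of the coefficient matrix into the
  rank-one perturbation \<open>2 a a\<^sup>T\<close> of the remaining matrix, which keeps the induction going.\<close>

lemma sum_exp_chaos_le:
  assumes "finite I" "\<And>j. A j j = 0" "\<And>j k. A j k = A k j"
    and "(\<Sum>j\<in>I. \<Sum>k\<in>I. (A j k)\<^sup>2) \<le> 1/25"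
  shows "(\<Sum>T\<in>Pow I. exp (chaos I A T)) \<le> 2 ^ card I * exp (2 * (\<Sum>j\<in>I. \<Sum>k\<in>I. (A j k)\<^sup>2))"
  using assms
proof (induction I arbitrary: A rule: finite_induct)
  case empty
  thus ?case by (simp add: chaos_def)
next
  case (insert i I)
  define a where "a = A i"
  define s where "s = (\<Sum>j\<in>I. (a j)\<^sup>2)"
  define q where "q = (\<Sum>j\<in>I. \<Sum>k\<in>I. (A j k)\<^sup>2)"
  define r where "r = sqrt q"
  define B where "B = (\<lambda>j k. if j = k then 0 else A j k + 2 * (a j * a k))"
  define b where "b = (\<Sum>j\<in>I. \<Sum>k\<in>I. (B j k)\<^sup>2)"
  have q0: "q \<ge> 0" and s0: "s \<ge> 0" unfolding q_def s_def by (auto intro!: sum_nonneg)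
  have r0: "r \<ge> 0" and rq: "r\<^sup>2 = q" using q0 by (simp_all add: r_def)
  have tot: "(\<Sum>j\<in>insert i I. \<Sum>k\<in>insert i I. (A j k)\<^sup>2) = q + 2 * s"
    using insert.hyps insert.prems(1) insert.prems(2)[of _ i]
    by (simp add: sum.distrib q_def s_def a_def)
  \<comment> \<open>The threshold 1/25 forces \<open>r\<close> \<le> 1/5 and \<open>s\<close> \<le>
    1/50, so the growth \<open>4 * (r * s) + 4 * (s * s)\<close> of the squared norm is at most 0.88
    \<open>s\<close>. It is paid for by the removed row and column, which frees
    \<open>2 * s\<close>.\<close>
  have le: "r\<^sup>2 + 2 * s \<le> 1/25" using insert.prems(3) tot rq by simp
  have "r\<^sup>2 \<le> (1/5)\<^sup>2" using le s0 by (simp add: power2_eq_square)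
  hence r5: "r \<le> 1/5" by (rule power2_le_imp_le) simp
  have s50: "s \<le> 1/50" using le zero_le_power2[of r] by linarith
  have rs: "r * s \<le> s * (1/5)" "s * s \<le> s * (1/50)"
    using mult_left_mono[OF r5 s0] mult_left_mono[OF s50 s0] by (simp_all add: mult.commute)
  have bexp: "b \<le> r\<^sup>2 + 4 * (r * s) + 4 * (s * s)"
    using frobenius_rank_one_le[OF rq[symmetric, unfolded q_def] r0 s_def]
    by (simp add: b_def B_def power2_eq_square algebra_simps)
  have IH: "(\<Sum>T\<in>Pow I. exp (chaos I B T)) \<le> 2 ^ card I * exp (2 * b)"
    unfolding b_def
  proof (rule insert.IH)
    show "B j j = 0" for j by (simp add: B_def)
    show "B j k = B k j" for j k using insert.prems(2)[of j k] by (simp add: B_def mult.commute)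
    have "b \<le> r\<^sup>2 + 2 * s" using bexp rs s0 by linarith
    thus "(\<Sum>j\<in>I. \<Sum>k\<in>I. (B j k)\<^sup>2) \<le> 1/25" using le by (simp add: b_def)
  qed
  have "(\<Sum>T\<in>Pow (insert i I). exp (chaos (insert i I) A T)) =
     (\<Sum>T\<in>Pow I. exp (chaos (insert i I) A T) + exp (chaos (insert i I) A (insert i T)))"
    using insert.hyps by (rule sum_Pow_insert)
  also have "\<dots> \<le> (\<Sum>T\<in>Pow I. 2 * exp (2 * s) * exp (chaos I B T))"
  proof (rule sum_mono)
    fix T assume T: "T \<in> Pow I"
    define x where "x = (\<Sum>j\<in>I. a j * flip T j)"
    have iT: "i \<notin> T" using T insert.hyps by auto
    have same: "flip (insert i T) j = flip T j" if "j \<in> I" for j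
      using that insert.hyps by (auto simp: flip_def)
    have "chaos I A (insert i T) = chaos I A T" "(\<Sum>j\<in>I. A i j * flip (insert i T) j) = x"
      by (simp_all add: chaos_def same x_def a_def)
    hence "exp (chaos (insert i I) A T) + exp (chaos (insert i I) A (insert i T)) =
        exp (chaos I A T) * (exp (2 * x) + exp (- (2 * x)))"
      using iT insert.hyps insert.prems
      by (simp add: chaos_insert x_def a_def flip_def[of _ i] exp_add[symmetric] distrib_left
          exp_diff exp_minus field_simps)
    also have "\<dots> \<le> exp (chaos I A T) * (2 * exp ((2 * x)\<^sup>2 / 2))"
      by (intro mult_left_mono exp_plus_exp_minus_le) auto
    also have "\<dots> = 2 * exp (chaos I A T + 2 * x\<^sup>2)"
      by (simp add: exp_add power_mult_distrib)
    also have "chaos I A T + 2 * x\<^sup>2 = 2 * s + chaos I B T"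
      unfolding x_def s_def B_def using insert.hyps insert.prems by (intro chaos_rank_one) auto
    finally show "exp (chaos (insert i I) A T) + exp (chaos (insert i I) A (insert i T)) \<le>
      2 * exp (2 * s) * exp (chaos I B T)" by (simp add: exp_add)
  qed
  also have "\<dots> \<le> 2 * exp (2 * s) * (2 ^ card I * exp (2 * b))"
    unfolding sum_distrib_left[symmetric] by (intro mult_left_mono IH) auto
  also have "\<dots> = 2 ^ card (insert i I) * exp (2 * s + 2 * b)"
    using insert.hyps by (simp add: exp_add)
  also have "\<dots> \<le> 2 ^ card (insert i I) * exp (2 * (q + 2 * s))"
  proof -
    \<comment> \<open>Of the available \<open>4 * s\<close>, the factor \<open>exp (2 * s)\<close>
      takes one half and the growth of \<open>2 * b\<close> at most the other.\<close>
    have "b \<le> r\<^sup>2 + s" using bexp rs s0 by linarith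
    hence "2 * s + 2 * b \<le> 2 * (q + 2 * s)" unfolding rq by (simp add: algebra_simps)
    thus ?thesis by simp
  qed
  finally show ?case using tot by simp
qed

section \<open>Averages over permutations\<close>

text \<open>A permutation \<open>q\<close> that works for the tails is corrected by the
  transposition of \<open>q x\<close> and \<open>y\<close>; neither of these occurs in the tail
  \<open>ys\<close>, so the earlier values survive.\<close>

lemma exists_permutes_map_eq:
  assumes "distinct xs" "distinct ys" "length xs = length ys" "set xs \<subseteq> S" "set ys \<subseteq> S"
  shows "\<exists>q. q permutes S \<and> map q xs = ys"
  using assms(3,1,2,4,5)
proof (induction xs ys rule: list_induct2)
  case Nil
  show ?case by (auto intro: exI[of _ id])
next
  case (Cons x xs y ys)
  then obtain q where q: "q permutes S" "map q xs = ys" by auto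
  have "q x \<notin> set ys"
    using q Cons.prems(1) permutes_inj[OF q(1)] by (auto simp: inj_eq)
  moreover have "y \<notin> set ys" using Cons.prems(2) by simp
  ultimately have "map (Transposition.transpose (q x) y) ys = ys"
    by (intro map_idI) (metis transpose_apply_other)
  moreover have "Transposition.transpose (q x) y \<circ> q permutes S"
    using q(1) Cons.prems permutes_in_image[OF q(1)]
    by (intro permutes_compose permutes_swap_id) auto
  moreover have "map (Transposition.transpose (q x) y \<circ> q) (x # xs) =
      y # map (Transposition.transpose (q x) y) (map q xs)" by simp
  ultimately show ?case unfolding q(2) by metis
qed

text \<open>Double counting over pairs of a permutation and a distinct list: the average over all
  permutations does not depend on the list.\<close>

lemma sum_permutes_map:
  fixes F :: "'c list \<Rightarrow> real"
  assumes "finite S" "distinct xs" "set xs \<subseteq> S"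
  defines "D \<equiv> {ys. length ys = length xs \<and> distinct ys \<and> set ys \<subseteq> S}"
  shows "real (card D) * (\<Sum>p | p permutes S. F (map p xs)) =
    real (card {p. p permutes S}) * (\<Sum>ys\<in>D. F ys)"
proof -
  have "(\<Sum>ys\<in>D. \<Sum>p | p permutes S. F (map p ys)) = (\<Sum>ys\<in>D. \<Sum>p | p permutes S. F (map p xs))"
  proof (rule sum.cong)
    fix ys assume "ys \<in> D"
    then obtain q where q: "q permutes S" "map q xs = ys"
      using exists_permutes_map_eq[of xs ys S] assms by (auto simp: D_def)
    show "(\<Sum>p | p permutes S. F (map p ys)) = (\<Sum>p | p permutes S. F (map p xs))"
      using sum_permutations_compose_right[OF q(1), of "\<lambda>p. F (map p xs)"]
      by (simp add: q(2)[symmetric])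
  qed simp
  \<comment> \<open>In the other order of summation, \<open>p\<close> acts bijectively on
    \<open>D\<close>, so the inner sum is the same for all \<open>p\<close>.\<close>
  moreover have "(\<Sum>ys\<in>D. F (map p ys)) = (\<Sum>ys\<in>D. F ys)" if p: "p permutes S" for p
  proof (rule sum.reindex_bij_witness[of _ "map (inv p)" "map p"])
    have inv: "inv p permutes S" using p by (rule permutes_inv)
    have mapD: "map r ys \<in> D" if "ys \<in> D" "r permutes S" for r ys
      using that permutes_in_image[OF that(2)] permutes_inj_on[OF that(2)]
      by (auto simp: D_def distinct_map)
    show "map p ys \<in> D" if "ys \<in> D" for ys using mapD[OF that p] .
    show "map (inv p) ys \<in> D" if "ys \<in> D" for ys using mapD[OF that inv] .
  qed (use p in \<open>auto simp: permutes_inv_o permutes_inverses\<close>)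
  hence "(\<Sum>ys\<in>D. \<Sum>p | p permutes S. F (map p ys)) = (\<Sum>p | p permutes S. \<Sum>ys\<in>D. F ys)"
    by (subst sum.swap) (rule sum.cong, auto)
  ultimately show ?thesis by simp
qed

lemma card_distinct_quadruples:
  assumes "n \<ge> 4"
  shows "real (card {ys. length ys = 4 \<and> distinct ys \<and> set ys \<subseteq> {1..n}}) =
    real n * (real n - 1) * (real n - 2) * (real n - 3)"
proof -
  obtain r where n: "n = r + 4" using assms by (metis le_Suc_ex add.commute)
  have "card {ys. length ys = 4 \<and> distinct ys \<and> set ys \<subseteq> {1..n}} =
      \<Prod>{card {1..n} - 4 + 1 .. card {1..n}}"
    using assms by (intro card_lists_distinct_length_eq) simp_all
  also have "{card {1..n} - 4 + 1 .. card {1..n}} = {r + 1, r + 2, r + 3, r + 4}"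
    unfolding n by auto
  also have "\<Prod>\<dots> = (r + 4) * (r + 3) * (r + 2) * (r + 1)" by simp
  finally have card: "card {ys. length ys = 4 \<and> distinct ys \<and> set ys \<subseteq> {1..n}} =
      (r + 4) * (r + 3) * (r + 2) * (r + 1)" .
  have "real n = real r + 4" by (simp add: n)
  thus ?thesis unfolding card by (simp add: algebra_simps)
qed

text \<open>Carries \<open>sum_permutes_map\<close> over from lists of length four to the tuples in
  \<open>U_perm\<close>: any fixed quadruple of distinct indices, permuted at random, has the
  U-statistic as its mean.\<close>

lemma sum_distinct_quadruples:
  fixes F :: "nat \<times> nat \<times> nat \<times> nat \<Rightarrow> real"
  assumes "n \<ge> 4" "distinct [a, b, c, d]" "{a, b, c, d} \<subseteq> {1..n}"
  shows "(\<Sum>p | p permutes {1..n}. F (p a, p b, p c, p d)) = fact n *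
    (1 / (real n * (real n - 1) * (real n - 2) * (real n - 3)) *
     (\<Sum>x \<in> {(i1, i2, i3, i4). {i1, i2, i3, i4} \<subseteq> {1..n} \<and> distinct [i1, i2, i3, i4]}. F x))"
    (is "?A = fact n * (1 / ?N * (\<Sum>x\<in>?Q. F x))")
proof -
  define D where "D = {ys. length ys = 4 \<and> distinct ys \<and> set ys \<subseteq> {1..n}}"
  define F' where "F' = (\<lambda>ys. F (ys ! 0, ys ! 1, ys ! 2, ys ! 3))"
  define l :: "nat \<times> nat \<times> nat \<times> nat \<Rightarrow> nat list"
    where "l = (\<lambda>(i1, i2, i3, i4). [i1, i2, i3, i4])"
  have len: "length [a, b, c, d] = 4" by simp
  have "real (card D) * (\<Sum>p | p permutes {1..n}. F' (map p [a, b, c, d])) =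
      real (card {p. p permutes {1..n}}) * (\<Sum>ys\<in>D. F' ys)"
  proof -
    have "set [a, b, c, d] \<subseteq> {1..n}" using assms(3) by simp
    from sum_permutes_map[OF finite_atLeastAtMost assms(2) this, of F'] show ?thesis
      unfolding len D_def .
  qed
  moreover have "F' (map p [a, b, c, d]) = F (p a, p b, p c, p d)" for p by (simp add: F'_def)
  moreover have "card {p. p permutes {1..n}} = fact n" by (rule card_permutations) auto
  moreover have "(\<Sum>ys\<in>D. F' ys) = (\<Sum>x\<in>?Q. F x)"
  proof -
    have "D = l ` ?Q"
    proof (intro set_eqI iffI)
      fix ys assume ys: "ys \<in> D"
      hence "length ys = Suc (Suc (Suc (Suc 0)))" by (simp add: D_def)
      then obtain i1 i2 i3 i4 where "ys = [i1, i2, i3, i4]"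
        unfolding length_Suc_conv length_0_conv by blast
      hence "ys = l (i1, i2, i3, i4)" "(i1, i2, i3, i4) \<in> ?Q" using ys by (simp_all add: l_def D_def)
      thus "ys \<in> l ` ?Q" by (rule image_eqI)
    qed (clarsimp simp: l_def D_def)
    moreover have "inj_on l ?Q" by (simp add: inj_on_def l_def split_paired_all)
    moreover have "F' (l x) = F x" for x by (cases x) (simp add: F'_def l_def)
    ultimately show ?thesis by (simp only: sum.reindex o_def)
  qed
  moreover have "real (card D) = ?N" unfolding D_def using assms(1) by (rule card_distinct_quadruples)
  ultimately have "?N * ?A = fact n * (\<Sum>x\<in>?Q. F x)" by (simp only: of_nat_fact)
  moreover have "?N \<noteq> 0" using assms(1) by auto
  moreover have "A = N * (1 / c * B)" if "c * A = N * B" "c \<noteq> 0" for A B c N :: real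
    using that by (simp add: eq_divide_eq mult.commute)
  ultimately show ?thesis by blast
qed

section \<open>Swapping the two halves of the index set\<close>

text \<open>The boolean names a member of the pair \<open>k\<close>, \<open>k + m\<close>, so that
  exchanging the pair amounts to negating it.\<close>

definition shift :: "nat \<Rightarrow> bool \<Rightarrow> nat \<Rightarrow> nat" where
  "shift m a k = (if a then k + m else k)"

text \<open>For \<open>T\<close> inside \<open>{1..m}\<close> this is an involution; indices beyond
  \<open>2 * m\<close>, such as the last one for odd \<open>n\<close>, stay fixed.\<close>

definition half_swap :: "nat \<Rightarrow> nat set \<Rightarrow> nat \<Rightarrow> nat" where
  "half_swap m T i = (if i \<in> T then i + m else if m < i \<and> i - m \<in> T then i - m else i)"

lemma half_swap_shift:
  assumes "T \<subseteq> {1..m}" "k \<in> {1..m}"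
  shows "half_swap m T (shift m a k) = shift m (a \<noteq> (k \<in> T)) k"
  using assms by (auto simp: half_swap_def shift_def)

lemma half_swap_permutes:
  assumes "T \<subseteq> {1..m}" "2 * m \<le> n"
  shows "half_swap m T permutes {1..n}"
proof (rule bij_imp_permutes)
  have invol: "half_swap m T (half_swap m T i) = i" for i
    using assms(1) by (auto simp: half_swap_def)
  have maps: "half_swap m T i \<in> {1..n}" if "i \<in> {1..n}" for i
    using assms that by (auto simp: half_swap_def dest!: subsetD[OF assms(1)])
  show "bij_betw (half_swap m T) {1..n} {1..n}"
    by (rule bij_betw_byWitness[of _ "half_swap m T"]) (use invol maps in auto)
  show "half_swap m T i = i" if "i \<notin> {1..n}" for i
    using assms that by (auto simp: half_swap_def dest!: subsetD[OF assms(1)])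
qed

definition offdiag :: "'i set \<Rightarrow> ('i \<times> 'i) set" where
  "offdiag I = {(i, j). i \<in> I \<and> j \<in> I \<and> i \<noteq> j}"

lemma finite_offdiag: "finite I \<Longrightarrow> finite (offdiag I)"
  by (rule finite_subset[of _ "I \<times> I"]) (auto simp: offdiag_def)

lemma sum_offdiag:
  fixes f :: "'i \<Rightarrow> 'i \<Rightarrow> real"
  assumes "finite I"
  shows "(\<Sum>i\<in>I. \<Sum>j\<in>I. if i = j then 0 else f i j) = (\<Sum>(i, j)\<in>offdiag I. f i j)"
proof -
  have "(\<Sum>i\<in>I. \<Sum>j\<in>I. if i = j then 0 else f i j) =
      (\<Sum>(i, j)\<in>I \<times> I. if i = j then 0 else f i j)"
    by (rule sum.cartesian_product)
  also have "\<dots> = (\<Sum>(i, j)\<in>offdiag I. if i = j then 0 else f i j)"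
    using assms by (intro sum.mono_neutral_right) (auto simp: offdiag_def)
  also have "\<dots> = (\<Sum>(i, j)\<in>offdiag I. f i j)"
    by (intro sum.cong) (auto simp: offdiag_def)
  finally show ?thesis .
qed

text \<open>For a uniform subset, membership of two distinct indices is a pair of independent fair
  bits: with \<open>k\<close> and \<open>l\<close> split off, every subset of the rest occurs once
  with each of the four patterns.\<close>

lemma sum_Pow_pattern:
  fixes f :: "bool \<Rightarrow> bool \<Rightarrow> real"
  assumes "finite I" "k \<in> I" "l \<in> I" "k \<noteq> l"
  shows "4 * (\<Sum>T\<in>Pow I. f (k \<in> T) (l \<in> T)) =
    2 ^ card I * (f True True + f True False + f False True + f False False)"
proof -
  define J where "J = I - {k, l}"
  have I: "I = insert k (insert l J)" and J: "finite J" "k \<notin> J" "l \<notin> J"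
    using assms by (auto simp: J_def)
  have "(\<Sum>T\<in>Pow I. f (k \<in> T) (l \<in> T)) =
     (\<Sum>T\<in>Pow J. (f (k \<in> T) (l \<in> T) + f (k \<in> insert k T) (l \<in> insert k T)) +
       (f (k \<in> insert l T) (l \<in> insert l T) +
        f (k \<in> insert k (insert l T)) (l \<in> insert k (insert l T))))"
    unfolding I using J assms(4) by (simp add: sum_Pow_insert del: Pow_insert)
  also have "\<dots> = (\<Sum>T\<in>Pow J. f False False + f True False + (f False True + f True True))"
  proof (rule sum.cong[OF refl])
    fix T assume "T \<in> Pow J"
    hence "k \<notin> T" "l \<notin> T" using J by auto
    thus "f (k \<in> T) (l \<in> T) + f (k \<in> insert k T) (l \<in> insert k T) +
       (f (k \<in> insert l T) (l \<in> insert l T) +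
        f (k \<in> insert k (insert l T)) (l \<in> insert k (insert l T))) =
      f False False + f True False + (f False True + f True True)"
      using assms(4) by simp
  qed
  also have "\<dots> = 2 ^ card J * (f False False + f True False + (f False True + f True True))"
    using J by (simp add: card_Pow)
  finally show ?thesis using J assms(4) by (simp add: I)
qed

text \<open>For symmetric \<open>G\<close>, this is one factor of \<open>h_in\<close> at the indices
  \<open>p k\<close>, \<open>p l\<close>, \<open>p (l + m)\<close>,
  \<open>p (k + m)\<close>.\<close>

definition quad :: "(nat \<Rightarrow> nat \<Rightarrow> real) \<Rightarrow> nat \<Rightarrow> (nat \<Rightarrow> nat) \<Rightarrow> nat \<Rightarrow> nat \<Rightarrow> real" where
  "quad G m p k l =
    G (p k) (p l) + G (p (k + m)) (p (l + m)) - G (p k) (p (l + m)) - G (p (k + m)) (p l)"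

lemma quad_commute:
  assumes "\<And>i j. G i j = G j i"
  shows "quad G m p k l = quad G m p l k"
  by (simp add: quad_def assms[of "p k"] assms[of "p (k + m)"])

text \<open>Exchanging \<open>k\<close> with \<open>k + m\<close> interchanges the positive and the
  negative terms, and so does exchanging \<open>l\<close> with \<open>l + m\<close>; two such
  exchanges cancel.\<close>

lemma quad_half_swap:
  assumes "T \<subseteq> {1..m}" "k \<in> {1..m}" "l \<in> {1..m}"
  shows "quad G m (p \<circ> half_swap m T) k l = quad G m p k l * (flip T k * flip T l)"
proof -
  have "quad G m q k l = G (q (shift m False k)) (q (shift m False l))
      + G (q (shift m True k)) (q (shift m True l)) - G (q (shift m False k)) (q (shift m True l))
      - G (q (shift m True k)) (q (shift m False l))" for q
    by (simp add: quad_def shift_def)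
  thus ?thesis using assms by (auto simp: half_swap_shift flip_def)
qed

text \<open>The booleans index the four terms of \<open>quad\<close>, so that a half swap acts by
  relabelling them.\<close>

definition cells :: "(nat \<Rightarrow> nat \<Rightarrow> real) \<Rightarrow> nat \<Rightarrow> (nat \<Rightarrow> nat) \<Rightarrow> nat \<Rightarrow> nat \<Rightarrow> bool \<Rightarrow> bool \<Rightarrow> real"
  where "cells G m p k l a b = (G (p (shift m a k)) (p (shift m b l)))\<^sup>2"

lemma quad_square_le:
  "(quad G m p k l)\<^sup>2 \<le> 4 * (\<Sum>a\<in>UNIV. \<Sum>b\<in>UNIV. cells G m p k l a b)"
proof -
  have "(w + x - y - z)\<^sup>2 \<le> 4 * (w\<^sup>2 + x\<^sup>2 + y\<^sup>2 + z\<^sup>2)" for w x y z :: real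
  proof -
    \<comment> \<open>Lagrange's identity for the vectors (w, x, y, z) and (1, 1, -1, -1), which
      proves this case of Cauchy-Schwarz.\<close>
    have "4 * (w\<^sup>2 + x\<^sup>2 + y\<^sup>2 + z\<^sup>2) - (w + x - y - z)\<^sup>2 =
        (w - x)\<^sup>2 + (w + y)\<^sup>2 + (w + z)\<^sup>2 + (x + y)\<^sup>2 + (x + z)\<^sup>2 + (y - z)\<^sup>2"
      by (simp add: power2_eq_square algebra_simps)
    also have "\<dots> \<ge> 0" by simp
    finally show ?thesis by simp
  qed
  from this[of "G (p k) (p l)" "G (p (k + m)) (p (l + m))" "G (p k) (p (l + m))"
      "G (p (k + m)) (p l)"] show ?thesis
    by (simp add: quad_def cells_def shift_def UNIV_bool algebra_simps)
qed

text \<open>The map from \<open>(k, l)\<close> and \<open>(a, b)\<close> to a pair of indices is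
  injective and avoids the diagonal because \<open>k\<close> \<noteq> \<open>l\<close>, so the left
  side is a partial sum of the nonnegative terms on the right.\<close>

lemma sum_cells_le:
  assumes "2 * m \<le> n"
  shows "(\<Sum>(k, l)\<in>offdiag {1..m}. \<Sum>a\<in>UNIV. \<Sum>b\<in>UNIV. cells G m p k l a b * cells H m q k l a b)
    \<le> (\<Sum>(i, j)\<in>offdiag {1..n}. (G (p i) (p j))\<^sup>2 * (H (q i) (q j))\<^sup>2)"
proof -
  define f where "f = (\<lambda>((k, l), (a, b)). (shift m a k, shift m b l))"
  have inj: "inj_on f (offdiag {1..m} \<times> UNIV)"
    by (auto simp: inj_on_def f_def shift_def offdiag_def split: if_splits)
  have "(\<Sum>(k, l)\<in>offdiag {1..m}. \<Sum>a\<in>UNIV. \<Sum>b\<in>UNIV. cells G m p k l a b * cells H m q k l a b) =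
      (\<Sum>x\<in>offdiag {1..m} \<times> UNIV. case f x of (i, j) \<Rightarrow> (G (p i) (p j))\<^sup>2 * (H (q i) (q j))\<^sup>2)"
    by (simp add: sum.cartesian_product' case_prod_unfold f_def cells_def
        flip: UNIV_Times_UNIV)
  also have "\<dots> = (\<Sum>(i, j)\<in>f ` (offdiag {1..m} \<times> UNIV). (G (p i) (p j))\<^sup>2 * (H (q i) (q j))\<^sup>2)"
    by (simp only: sum.reindex[OF inj] o_def)
  also have "\<dots> \<le> (\<Sum>(i, j)\<in>offdiag {1..n}. (G (p i) (p j))\<^sup>2 * (H (q i) (q j))\<^sup>2)"
  proof (rule sum_mono2)
    show "f ` (offdiag {1..m} \<times> UNIV) \<subseteq> offdiag {1..n}"
      using assms by (auto simp: f_def shift_def offdiag_def split: if_splits)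
  qed (auto intro: finite_offdiag)
  finally show ?thesis .
qed

text \<open>Under a uniformly random \<open>T\<close> the cell of \<open>q \<circ> half_swap m T\<close> paired with a given cell
  of \<open>p\<close> is uniform among the four cells, so the mean of the diagonal sums \<open>\<Sum> cells * cells\<close> is a
  quarter of the product of the two full sums.\<close>

lemma sum_quad_squares_le:
  assumes "2 * m \<le> n" and q: "q permutes {1..n}"
    and S: "\<And>q. q permutes {1..n} \<Longrightarrow>
      (\<Sum>(i, j)\<in>offdiag {1..n}. (G (p i) (p j))\<^sup>2 * (H (q i) (q j))\<^sup>2) \<le> S"
  shows "(\<Sum>(k, l)\<in>offdiag {1..m}. (quad G m p k l)\<^sup>2 * (quad H m q k l)\<^sup>2) \<le> 64 * S"
proof -
  let ?g = "\<lambda>k l. \<Sum>a\<in>UNIV. \<Sum>b\<in>UNIV. cells G m p k l a b"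
  let ?h = "\<lambda>k l. \<Sum>a\<in>UNIV. \<Sum>b\<in>UNIV. cells H m q k l a b"
  let ?c = "\<lambda>T k l. \<Sum>a\<in>UNIV. \<Sum>b\<in>UNIV.
    cells G m p k l a b * cells H m (q \<circ> half_swap m T) k l a b"
  have avg: "4 * (\<Sum>T\<in>Pow {1..m}. ?c T k l) = 2 ^ m * (?g k l * ?h k l)"
    if "(k, l) \<in> offdiag {1..m}" for k l
  proof -
    have kl: "k \<in> {1..m}" "l \<in> {1..m}" "k \<noteq> l" using that by (auto simp: offdiag_def)
    define f where "f = (\<lambda>u v. \<Sum>a\<in>UNIV. \<Sum>b\<in>UNIV.
      cells G m p k l a b * cells H m q k l (a \<noteq> u) (b \<noteq> v))"
    have "(\<Sum>T\<in>Pow {1..m}. ?c T k l) = (\<Sum>T\<in>Pow {1..m}. f (k \<in> T) (l \<in> T))"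
    proof (rule sum.cong)
      fix T assume "T \<in> Pow {1..m}"
      hence T: "T \<subseteq> {1..m}" by simp
      show "?c T k l = f (k \<in> T) (l \<in> T)"
        unfolding f_def cells_def o_def half_swap_shift[OF T kl(1)] half_swap_shift[OF T kl(2)] ..
    qed simp
    hence "4 * (\<Sum>T\<in>Pow {1..m}. ?c T k l) =
        2 ^ m * (f True True + f True False + f False True + f False False)"
      using sum_Pow_pattern[OF _ kl, of f] by simp
    \<comment> \<open>Each cell of \<open>G\<close> meets each cell of \<open>H\<close> for exactly
      one choice of the two bits.\<close>
    also have "f True True + f True False + f False True + f False False = ?g k l * ?h k l"
      by (simp add: f_def UNIV_bool algebra_simps)
    finally show ?thesis .
  qed
  have "2 ^ m * (\<Sum>(k, l)\<in>offdiag {1..m}. (quad G m p k l)\<^sup>2 * (quad H m q k l)\<^sup>2) \<le>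
      2 ^ m * (\<Sum>(k, l)\<in>offdiag {1..m}. (4 * ?g k l) * (4 * ?h k l))"
    by (intro mult_left_mono sum_mono)
      (auto simp only: split_def intro!: mult_mono quad_square_le mult_nonneg_nonneg sum_nonneg
        zero_le_power2 zero_le_numeral zero_le_power, auto simp: cells_def)
  \<comment> \<open>The factor 64 is 4 * 4 from \<open>quad_square_le\<close>, used for both
    kernels, times 4 from \<open>avg\<close>.\<close>
  also have "\<dots> = 64 * (\<Sum>(k, l)\<in>offdiag {1..m}. \<Sum>T\<in>Pow {1..m}. ?c T k l)"
    unfolding sum_distrib_left[of _ _ "offdiag {1..m}"]
  proof (rule sum.cong[OF refl])
    fix x assume "x \<in> offdiag {1..m}"
    moreover obtain k l where x: "x = (k, l)" by (cases x)
    ultimately have kl: "(k, l) \<in> offdiag {1..m}" by simp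
    show "2 ^ m * (case x of (k, l) \<Rightarrow> (4 * ?g k l) * (4 * ?h k l)) =
      64 * (case x of (k, l) \<Rightarrow> \<Sum>T\<in>Pow {1..m}. ?c T k l)"
      using avg[OF kl] unfolding x split by linarith
  qed
  also have "(\<Sum>(k, l)\<in>offdiag {1..m}. \<Sum>T\<in>Pow {1..m}. ?c T k l) =
      (\<Sum>T\<in>Pow {1..m}. \<Sum>(k, l)\<in>offdiag {1..m}. ?c T k l)"
    unfolding split_def by (rule sum.swap)
  also have "\<dots> \<le> (\<Sum>T\<in>Pow {1..m}. S)"
  proof (rule sum_mono)
    fix T assume "T \<in> Pow {1..m}"
    hence "half_swap m T permutes {1..n}" using assms(1) by (intro half_swap_permutes) auto
    hence "q \<circ> half_swap m T permutes {1..n}" using q by (rule permutes_compose)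
    from S[OF this] show "(\<Sum>(k, l)\<in>offdiag {1..m}. ?c T k l) \<le> S"
      by (rule order_trans[OF sum_cells_le[OF assms(1)]])
  qed
  finally have "2 ^ m * (\<Sum>(k, l)\<in>offdiag {1..m}. (quad G m p k l)\<^sup>2 * (quad H m q k l)\<^sup>2) \<le>
      2 ^ m * (64 * S)" by (simp add: card_Pow)
  thus ?thesis by simp
qed

section \<open>The permuted statistic as an average of decoupled sums\<close>

text \<open>Two separate permutations allow the arguments of \<open>q\<close> to be swapped while
  \<open>p\<close> is held fixed; the statistic itself corresponds to
  \<open>q = \<pi> \<circ> p\<close>.\<close>

definition paired_sum ::
  "nat \<Rightarrow> (nat \<Rightarrow> nat \<Rightarrow> real) \<Rightarrow> (nat \<Rightarrow> nat \<Rightarrow> real) \<Rightarrow> (nat \<Rightarrow> nat) \<Rightarrow> (nat \<Rightarrow> nat) \<Rightarrow> real" where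
  "paired_sum m G H p q = (\<Sum>(k, l)\<in>offdiag {1..m}. quad G m p k l * quad H m q k l)"

lemma card_permutes_interval: "real (card {p. p permutes {1..n}}) = fact n"
proof -
  have "card {p. p permutes {1..n}} = fact n" by (rule card_permutations) auto
  thus ?thesis by (simp only: of_nat_fact)
qed

lemma card_offdiag:
  assumes "finite I"
  shows "real (card (offdiag I)) = real (card I) * (real (card I) - 1)"
proof -
  have "real (card (offdiag I)) = (\<Sum>(i, j)\<in>offdiag I. 1)" by simp
  also have "\<dots> = (\<Sum>i\<in>I. \<Sum>j\<in>I. if i = j then 0 else 1)"
    using assms by (rule sum_offdiag[symmetric])
  also have "\<dots> = (\<Sum>i\<in>I. \<Sum>j\<in>I. 1 - (if i = j then 1 else 0))"
    by (intro sum.cong) auto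
  also have "\<dots> = real (card I) * (real (card I) - 1)"
    using assms by (simp add: sum_subtractf)
  finally show ?thesis .
qed

text \<open>For each of the \<open>m * (m - 1)\<close> pairs the indices \<open>k\<close>,
  \<open>l\<close>, \<open>l + m\<close>, \<open>k + m\<close> are distinct, so every summand has
  mean \<open>U_perm\<close> under a uniform \<open>r\<close>.\<close>

lemma sum_paired_sum_eq_U_perm:
  assumes "n \<ge> 4" "2 * m \<le> n" and G: "\<And>i j. G i j = G j i" and H: "\<And>i j. H i j = H j i"
  shows "(\<Sum>r | r permutes {1..n}. paired_sum m G H r (p \<circ> r)) =
    real m * (real m - 1) * (fact n * U_perm n G H id id p)"
proof -
  have "(\<Sum>r | r permutes {1..n}. paired_sum m G H r (p \<circ> r)) =
      (\<Sum>(k, l)\<in>offdiag {1..m}. \<Sum>r | r permutes {1..n}. quad G m r k l * quad H m (p \<circ> r) k l)"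
    unfolding paired_sum_def split_def by (rule sum.swap)
  also have "\<dots> = (\<Sum>(k, l)\<in>offdiag {1..m}. fact n * U_perm n G H id id p)"
  proof (rule sum.cong[OF refl], clarify)
    fix k l assume kl: "(k, l) \<in> offdiag {1..m}"
    define F where "F = (\<lambda>(i1, i2, i3, i4).
      h_in G H (id i1, id (p i1)) (id i2, id (p i2)) (id i3, id (p i3)) (id i4, id (p i4)))"
    have "quad G m r k l * quad H m (p \<circ> r) k l = F (r k, r l, r (l + m), r (k + m))" for r
      by (simp add: F_def h_in_def quad_def G[of "r (k + m)"] H[of "p (r (k + m))"])
    hence "(\<Sum>r | r permutes {1..n}. quad G m r k l * quad H m (p \<circ> r) k l) =
        (\<Sum>r | r permutes {1..n}. F (r k, r l, r (l + m), r (k + m)))" by simp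
    also have "\<dots> = fact n * U_perm n G H id id p"
      unfolding U_perm_def F_def[symmetric]
      using assms(1,2) kl by (intro sum_distinct_quadruples) (auto simp: offdiag_def)
    finally show "(\<Sum>r | r permutes {1..n}. quad G m r k l * quad H m (p \<circ> r) k l) =
        fact n * U_perm n G H id id p" .
  qed
  also have "\<dots> = real m * (real m - 1) * (fact n * U_perm n G H id id p)"
    by (simp add: split_def card_offdiag)
  finally show ?thesis .
qed

section \<open>Exponential moments of the paired sum and of the statistic\<close>

lemma exp_average_le:
  fixes f :: "'i \<Rightarrow> real"
  assumes "finite S" "S \<noteq> {}"
  shows "exp ((\<Sum>x\<in>S. f x) / real (card S)) \<le> (\<Sum>x\<in>S. exp (f x)) / real (card S)"
proof -
  have "exp (\<Sum>x\<in>S. (1 / real (card S)) *\<^sub>R f x) \<le> (\<Sum>x\<in>S. 1 / real (card S) * exp (f x))"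
    using assms convex_on_exp[of 1] by (intro convex_on_sum[where C = UNIV]) auto
  thus ?thesis by (simp add: sum_divide_distrib)
qed

text \<open>The uniform law of \<open>q\<close> is invariant under composition with
  \<open>half_swap m T\<close>, so an average over \<open>T\<close> may be inserted. For fixed
  \<open>q\<close> that average is over a Rademacher chaos with squared Frobenius norm at most
  \<open>64 * c\<^sup>2 * S\<close>, and \<open>sum_exp_chaos_le\<close> doubles this in the
  exponent.\<close>

lemma sum_exp_paired_sum_le:
  assumes mn: "2 * m \<le> n"
    and G: "\<And>i j. G i j = G j i" and H: "\<And>i j. H i j = H j i"
    and S: "\<And>q. q permutes {1..n} \<Longrightarrow>
      (\<Sum>(i, j)\<in>offdiag {1..n}. (G (p i) (p j))\<^sup>2 * (H (q i) (q j))\<^sup>2) \<le> S"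
    and c: "64 * c\<^sup>2 * S \<le> 1/25"
  shows "(\<Sum>q | q permutes {1..n}. exp (c * paired_sum m G H p q)) \<le> fact n * exp (128 * c\<^sup>2 * S)"
proof -
  let ?P = "{q. q permutes {1..n}}"
  have "2 ^ m * (\<Sum>q\<in>?P. exp (c * paired_sum m G H p q)) =
      (\<Sum>T\<in>Pow {1..m}. \<Sum>q\<in>?P. exp (c * paired_sum m G H p (q \<circ> half_swap m T)))"
  proof -
    have "(\<Sum>q\<in>?P. exp (c * paired_sum m G H p (q \<circ> half_swap m T))) =
        (\<Sum>q\<in>?P. exp (c * paired_sum m G H p q))" if "T \<in> Pow {1..m}" for T
      using that mn by (intro sum_permutations_compose_right[symmetric] half_swap_permutes) auto
    thus ?thesis by (simp add: card_Pow)
  qed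
  also have "\<dots> = (\<Sum>q\<in>?P. \<Sum>T\<in>Pow {1..m}. exp (c * paired_sum m G H p (q \<circ> half_swap m T)))"
    by (rule sum.swap)
  also have "\<dots> \<le> (\<Sum>q\<in>?P. 2 ^ m * exp (128 * c\<^sup>2 * S))"
  proof (rule sum_mono)
    fix q assume "q \<in> ?P"
    hence q: "q permutes {1..n}" by simp
    define A where "A = (\<lambda>k l. if k = l then 0 else c * (quad G m p k l * quad H m q k l))"
    have chaos: "c * paired_sum m G H p (q \<circ> half_swap m T) = chaos {1..m} A T"
      if "T \<in> Pow {1..m}" for T
    proof -
      have "chaos {1..m} A T = (\<Sum>k\<in>{1..m}. \<Sum>l\<in>{1..m}. if k = l then 0
          else c * (quad G m p k l * quad H m q k l) * (flip T k * flip T l))"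
        unfolding chaos_def by (intro sum.cong refl) (simp add: A_def)
      also have "\<dots> = (\<Sum>(k, l)\<in>offdiag {1..m}.
          c * (quad G m p k l * quad H m q k l) * (flip T k * flip T l))"
        by (rule sum_offdiag) simp
      \<comment> \<open>Only the second factor sees the swap, so the sign product enters once and
        does not cancel.\<close>
      also have "\<dots> = (\<Sum>(k, l)\<in>offdiag {1..m}.
          c * (quad G m p k l * quad H m (q \<circ> half_swap m T) k l))"
        using that by (intro sum.cong refl) (auto simp: quad_half_swap offdiag_def)
      also have "\<dots> = c * paired_sum m G H p (q \<circ> half_swap m T)"
        by (simp add: paired_sum_def sum_distrib_left split_def)
      finally show ?thesis ..
    qed
    have "(\<Sum>k\<in>{1..m}. \<Sum>l\<in>{1..m}. (A k l)\<^sup>2) = (\<Sum>k\<in>{1..m}. \<Sum>l\<in>{1..m}.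
        if k = l then 0 else c\<^sup>2 * ((quad G m p k l)\<^sup>2 * (quad H m q k l)\<^sup>2))"
      by (intro sum.cong refl) (simp add: A_def power_mult_distrib)
    also have "\<dots> = (\<Sum>(k, l)\<in>offdiag {1..m}. c\<^sup>2 * ((quad G m p k l)\<^sup>2 * (quad H m q k l)\<^sup>2))"
      by (rule sum_offdiag) simp
    also have "\<dots> = c\<^sup>2 * (\<Sum>(k, l)\<in>offdiag {1..m}. (quad G m p k l)\<^sup>2 * (quad H m q k l)\<^sup>2)"
      by (simp add: sum_distrib_left split_def)
    also have "\<dots> \<le> c\<^sup>2 * (64 * S)"
      using mn q S by (intro mult_left_mono sum_quad_squares_le) auto
    finally have A2: "(\<Sum>k\<in>{1..m}. \<Sum>l\<in>{1..m}. (A k l)\<^sup>2) \<le> 64 * c\<^sup>2 * S" by linarith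
    have "(\<Sum>T\<in>Pow {1..m}. exp (c * paired_sum m G H p (q \<circ> half_swap m T))) =
        (\<Sum>T\<in>Pow {1..m}. exp (chaos {1..m} A T))"
      by (intro sum.cong refl) (simp only: chaos)
    also have "\<dots> \<le> 2 ^ card {1..m} * exp (2 * (\<Sum>k\<in>{1..m}. \<Sum>l\<in>{1..m}. (A k l)\<^sup>2))"
    proof (rule sum_exp_chaos_le)
      show "A j k = A k j" for j k
        using quad_commute[of G m p j k] quad_commute[of H m q j k] G H by (simp add: A_def)
    qed (use A2 c in \<open>auto simp: A_def\<close>)
    also have "\<dots> \<le> 2 ^ m * exp (128 * c\<^sup>2 * S)"
    proof -
      have "2 * (\<Sum>k\<in>{1..m}. \<Sum>l\<in>{1..m}. (A k l)\<^sup>2) \<le> 128 * c\<^sup>2 * S" using A2 by linarith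
      thus ?thesis
        unfolding card_atLeastAtMost diff_Suc_1 by (intro mult_left_mono) (simp_all only: exp_le_cancel_iff, simp)
    qed
    finally show "(\<Sum>T\<in>Pow {1..m}. exp (c * paired_sum m G H p (q \<circ> half_swap m T))) \<le>
      2 ^ m * exp (128 * c\<^sup>2 * S)" .
  qed
  also have "\<dots> = 2 ^ m * (fact n * exp (128 * c\<^sup>2 * S))"
    by (simp only: sum_constant card_permutes_interval mult_ac)
  finally show ?thesis by simp
qed

text \<open>Odd \<open>n = 2 * m + 1\<close> is the worst case for given \<open>m\<close>; the
  factor 10 is attained at \<open>n = 5\<close>.\<close>

lemma half_pairs_ge:
  assumes "n \<ge> 4"
  shows "real n * (real n - 1) \<le> 10 * (real (n div 2) * (real (n div 2) - 1))"
proof -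
  define m where "m = n div 2"
  have "m \<ge> 2" "n \<le> 2 * m + 1" "n \<ge> 2 * m" using assms by (auto simp: m_def)
  hence m: "real m \<ge> 2" "real n \<le> 2 * real m + 1" "real n \<ge> 2 * real m" by linarith+
  have "real n * (real n - 1) \<le> (2 * real m + 1) * (2 * real m)"
    using m by (intro mult_mono) auto
  also have "\<dots> = 10 * (real m * (real m - 1)) - 6 * (real m * (real m - 2))"
    by (simp add: algebra_simps)
  also have "\<dots> \<le> 10 * (real m * (real m - 1))" using m by simp
  finally show ?thesis by (simp add: m_def)
qed

text \<open>Jensen's inequality for the average over \<open>r\<close>, followed by the paired-sum
  bound with \<open>c = x / M\<close>. Replacing the normalisation \<open>N\<close> by
  \<open>10 * M\<close> costs a factor 100, which turns 64 and 128 into 6400 and 12800.\<close>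

lemma sum_exp_U_perm_le:
  assumes n: "n \<ge> 4"
    and G: "\<And>i j. G i j = G j i" and H: "\<And>i j. H i j = H j i"
    and S: "\<And>p q. p permutes {1..n} \<Longrightarrow> q permutes {1..n} \<Longrightarrow>
      (\<Sum>(i, j)\<in>offdiag {1..n}. (G (p i) (p j))\<^sup>2 * (H (q i) (q j))\<^sup>2) \<le>
        (real n)\<^sup>2 * (real n - 1)\<^sup>2 * s\<^sup>2"
    and c: "6400 * x\<^sup>2 * s\<^sup>2 \<le> 1/25"
  shows "(\<Sum>p | p permutes {1..n}. exp (x * U_perm n G H id id p)) \<le>
    fact n * exp (12800 * x\<^sup>2 * s\<^sup>2)"
proof -
  let ?P = "{q. q permutes {1..n}}"
  define m where "m = n div 2"
  define M where "M = real m * (real m - 1)"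
  define N where "N = real n * (real n - 1)"
  have mn: "2 * m \<le> n" by (simp add: m_def)
  have "m \<ge> 2" using n by (simp add: m_def)
  hence M: "M > 0" by (simp add: M_def)
  have N: "N \<ge> 0" "N \<le> 10 * M" using half_pairs_ge[OF n] n by (simp_all add: N_def M_def m_def)
  have "N\<^sup>2 \<le> (10 * M)\<^sup>2" using N by (intro power_mono) auto
  hence "(x / M)\<^sup>2 * (N\<^sup>2 * s\<^sup>2) \<le> (x / M)\<^sup>2 * ((10 * M)\<^sup>2 * s\<^sup>2)"
    by (intro mult_left_mono mult_right_mono) auto
  hence K: "(x / M)\<^sup>2 * (N\<^sup>2 * s\<^sup>2) \<le> 100 * x\<^sup>2 * s\<^sup>2"
  proof -
    have "(x / M)\<^sup>2 * ((10 * M)\<^sup>2 * s\<^sup>2) = 100 * x\<^sup>2 * s\<^sup>2"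
      using M by (simp add: power_mult_distrib power_divide)
    thus ?thesis using \<open>(x / M)\<^sup>2 * (N\<^sup>2 * s\<^sup>2) \<le> _\<close> by linarith
  qed
  have cardP: "real (card ?P) = fact n" by (rule card_permutes_interval)
  have finP: "finite ?P" by (intro finite_permutations) simp
  have neP: "?P \<noteq> {}" by (metis permutes_id mem_Collect_eq empty_iff)
  have "(\<Sum>p\<in>?P. \<Sum>r\<in>?P. exp (x / M * paired_sum m G H r (p \<circ> r))) =
      (\<Sum>r\<in>?P. \<Sum>p\<in>?P. exp (x / M * paired_sum m G H r (p \<circ> r)))"
    by (rule sum.swap)
  \<comment> \<open>Decoupling: for fixed \<open>r\<close>, the composite \<open>p \<circ> r\<close>
    runs over all permutations as \<open>p\<close> does.\<close>
  also have "\<dots> = (\<Sum>r\<in>?P. \<Sum>q\<in>?P. exp (x / M * paired_sum m G H r q))"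
  proof (rule sum.cong[OF refl])
    fix r assume "r \<in> ?P"
    thus "(\<Sum>p\<in>?P. exp (x / M * paired_sum m G H r (p \<circ> r))) =
        (\<Sum>q\<in>?P. exp (x / M * paired_sum m G H r q))"
      using sum_permutations_compose_right[of r "{1..n}" "\<lambda>q. exp (x / M * paired_sum m G H r q)"]
      by simp
  qed
  also have "\<dots> \<le> (\<Sum>r\<in>?P. fact n * exp (128 * (x / M)\<^sup>2 * (N\<^sup>2 * s\<^sup>2)))"
  proof (rule sum_mono)
    fix r assume "r \<in> ?P"
    hence r: "r permutes {1..n}" by simp
    show "(\<Sum>q\<in>?P. exp (x / M * paired_sum m G H r q)) \<le>
      fact n * exp (128 * (x / M)\<^sup>2 * (N\<^sup>2 * s\<^sup>2))"
    proof (rule sum_exp_paired_sum_le[OF mn G H])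
      show "(\<Sum>(i, j)\<in>offdiag {1..n}. (G (r i) (r j))\<^sup>2 * (H (q i) (q j))\<^sup>2) \<le> N\<^sup>2 * s\<^sup>2"
        if "q permutes {1..n}" for q
        using S[OF r that] by (simp only: N_def power_mult_distrib)
      show "64 * (x / M)\<^sup>2 * (N\<^sup>2 * s\<^sup>2) \<le> 1/25" using K c by linarith
    qed
  qed
  also have "\<dots> = fact n * (fact n * exp (128 * (x / M)\<^sup>2 * (N\<^sup>2 * s\<^sup>2)))"
    by (simp only: sum_constant cardP)
  also have "\<dots> \<le> fact n * (fact n * exp (12800 * x\<^sup>2 * s\<^sup>2))"
  proof -
    have "128 * (x / M)\<^sup>2 * (N\<^sup>2 * s\<^sup>2) \<le> 12800 * x\<^sup>2 * s\<^sup>2" using K by linarith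
    hence "exp (128 * (x / M)\<^sup>2 * (N\<^sup>2 * s\<^sup>2)) \<le> exp (12800 * x\<^sup>2 * s\<^sup>2)"
      by (simp only: exp_le_cancel_iff)
    thus ?thesis by (rule mult_left_mono[OF mult_left_mono]) simp_all
  qed
  finally have le: "(\<Sum>p\<in>?P. \<Sum>r\<in>?P. exp (x / M * paired_sum m G H r (p \<circ> r))) \<le>
    fact n * (fact n * exp (12800 * x\<^sup>2 * s\<^sup>2))" .
  have "(\<Sum>p\<in>?P. exp (x * U_perm n G H id id p)) \<le>
      (\<Sum>p\<in>?P. (\<Sum>r\<in>?P. exp (x / M * paired_sum m G H r (p \<circ> r))) / fact n)"
  proof (rule sum_mono)
    fix p
    have eq: "(\<Sum>r\<in>?P. x / M * paired_sum m G H r (p \<circ> r)) / real (card ?P) =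
      x * U_perm n G H id id p"
    proof -
      have "(\<Sum>r\<in>?P. paired_sum m G H r (p \<circ> r)) = M * (fact n * U_perm n G H id id p)"
        unfolding M_def by (rule sum_paired_sum_eq_U_perm[OF n mn G H])
      moreover have "x / M * (M * (fact n * u)) / fact n = x * u" for u using M by simp
      ultimately show ?thesis by (simp only: sum_distrib_left[symmetric] cardP)
    qed
    show "exp (x * U_perm n G H id id p) \<le>
        (\<Sum>r\<in>?P. exp (x / M * paired_sum m G H r (p \<circ> r))) / fact n"
      using exp_average_le[OF finP neP, of "\<lambda>r. x / M * paired_sum m G H r (p \<circ> r)"]
      unfolding eq unfolding cardP .
  qed
  also have "\<dots> = (\<Sum>p\<in>?P. \<Sum>r\<in>?P. exp (x / M * paired_sum m G H r (p \<circ> r))) / fact n"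
    by (simp only: sum_divide_distrib)
  also have "\<dots> \<le> fact n * (fact n * exp (12800 * x\<^sup>2 * s\<^sup>2)) / fact n"
    using le by (rule divide_right_mono) simp
  also have "\<dots> = fact n * exp (12800 * x\<^sup>2 * s\<^sup>2)" by simp
  finally show ?thesis .
qed

section \<open>The tail bound\<close>

lemma Sigma_n_nonneg: "Sigma_n n gY gZ Y Z \<ge> 0"
proof -
  define f where "f = (\<lambda>p. \<Sum>(i1, i2) \<in> {(i1, i2). i1 \<in> {1..n} \<and> i2 \<in> {1..n} \<and> i1 \<noteq> i2}.
    (gY (Y i1) (Y i2))\<^sup>2 * (gZ (Z (p i1)) (Z (p i2)))\<^sup>2)"
  have f0: "f p \<ge> 0" for p unfolding f_def by (intro sum_nonneg) auto
  have "bdd_above (f ` {p. p permutes {1..n}})"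
    by (intro bdd_above_finite finite_imageI finite_permutations) simp
  hence "0 \<le> (SUP p \<in> {p. p permutes {1..n}}. f p)"
    by (rule cSUP_upper2[of _ _ id]) (simp_all only: f0 mem_Collect_eq permutes_id)
  thus ?thesis
    unfolding Sigma_n_def f_def[symmetric] by (intro real_sqrt_ge_zero mult_nonneg_nonneg) auto
qed

text \<open>Relabelling the indices by \<open>p\<close> shows that the sum depends on
  \<open>p\<close> and \<open>q\<close> only through \<open>q \<circ> inv p\<close>, so the supremum
  over a single permutation suffices.\<close>

lemma Sigma_n_ge:
  assumes n: "n \<ge> 4" and p: "p permutes {1..n}" and q: "q permutes {1..n}"
  shows "(\<Sum>(i, j)\<in>offdiag {1..n}. (G (p i) (p j))\<^sup>2 * (H (q i) (q j))\<^sup>2) \<le>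
    (real n)\<^sup>2 * (real n - 1)\<^sup>2 * (Sigma_n n G H id id)\<^sup>2"
proof -
  let ?P = "{p. p permutes {1..n}}"
  define f where "f = (\<lambda>p. \<Sum>(i, j)\<in>offdiag {1..n}. (G i j)\<^sup>2 * (H (p i) (p j))\<^sup>2)"
  have f0: "f r \<ge> 0" for r unfolding f_def by (intro sum_nonneg) auto
  have bdd: "bdd_above (f ` ?P)" by (intro bdd_above_finite finite_imageI finite_permutations) simp
  have le: "f r \<le> (SUP p\<in>?P. f p)" if "r \<in> ?P" for r using that bdd by (intro cSUP_upper)
  define N where "N = (real n)\<^sup>2 * (real n - 1)\<^sup>2"
  have N: "N > 0" using n by (simp add: N_def)
  have "0 \<le> f id" by (rule f0)
  also have "f id \<le> (SUP p\<in>?P. f p)" by (intro le) (simp add: permutes_id)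
  finally have "0 \<le> 1 / N * (SUP p\<in>?P. f p)" using N by (intro mult_nonneg_nonneg) auto
  moreover have "Sigma_n n G H id id = sqrt (1 / N * (SUP p\<in>?P. f p))"
    by (simp only: Sigma_n_def f_def offdiag_def N_def id_apply)
  ultimately have "(Sigma_n n G H id id)\<^sup>2 = 1 / N * (SUP p\<in>?P. f p)"
    by (simp only: real_sqrt_pow2)
  moreover have "X = N * (1 / N * X)" for X using N by simp
  ultimately have Sig: "(SUP p\<in>?P. f p) = N * (Sigma_n n G H id id)\<^sup>2" by (simp only:)
  have "(\<Sum>(i, j)\<in>offdiag {1..n}. (G (p i) (p j))\<^sup>2 * (H (q i) (q j))\<^sup>2) = f (q \<circ> inv p)"
    unfolding f_def
  proof (rule sum.reindex_bij_witness[of _ "map_prod (inv p) (inv p)" "map_prod p p"])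
    have map_offdiag: "map_prod r r x \<in> offdiag {1..n}"
      if "x \<in> offdiag {1..n}" "r permutes {1..n}" for r :: "nat \<Rightarrow> nat" and x
    proof -
      obtain i j where x: "x = (i, j)" by (cases x)
      have "r i \<in> {1..n} \<longleftrightarrow> i \<in> {1..n}" "r j \<in> {1..n} \<longleftrightarrow> j \<in> {1..n}" "r i = r j \<longleftrightarrow> i = j"
        using permutes_in_image[OF that(2)] inj_eq[OF permutes_inj[OF that(2)]] by blast+
      thus ?thesis using that(1) by (simp only: x offdiag_def map_prod_simp mem_Collect_eq split) blast
    qed
    show "map_prod p p x \<in> offdiag {1..n}" if "x \<in> offdiag {1..n}" for x
      using map_offdiag[OF that p] .
    show "map_prod (inv p) (inv p) x \<in> offdiag {1..n}" if "x \<in> offdiag {1..n}" for x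
      using map_offdiag[OF that permutes_inv[OF p]] .
  qed (auto simp: permutes_inverses[OF p])
  also have "\<dots> \<le> (SUP p\<in>?P. f p)"
    using p q by (intro le) (simp add: permutes_compose permutes_inv)
  finally show ?thesis unfolding Sig N_def .
qed

text \<open>Chernoff's bound. With \<open>u\<close> the minimum in the exponent and
  \<open>x = u / (25600 * t)\<close>, at least half of the linear gain \<open>x * t\<close> survives
  the quadratic term, which leaves \<open>u / 51200\<close>.\<close>

lemma prob_U_perm_ge_le:
  assumes n: "n \<ge> 4"
    and G: "\<And>i j. G i j = G j i" and H: "\<And>i j. H i j = H j i" and t: "t > 0"
  shows "measure_pmf.prob (pmf_of_set {p. p permutes {1..n}}) {p. U_perm n G H id id p \<ge> t} \<le>
    exp_tail (1/51200) (Sigma_n n G H id id) t"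
proof -
  define s where "s = Sigma_n n G H id id"
  let ?pr = "measure_pmf.prob (pmf_of_set {p. p permutes {1..n}}) {p. U_perm n G H id id p \<ge> t}"
  have bound: "?pr \<le> exp (12800 * x\<^sup>2 * s\<^sup>2 - x * t)"
    if x: "x > 0" "6400 * x\<^sup>2 * s\<^sup>2 \<le> 1/25" for x
  proof -
    let ?P = "{q. q permutes {1..n}}"
    let ?E = "{p. U_perm n G H id id p \<ge> t}"
    have cardP: "real (card ?P) = fact n" by (rule card_permutes_interval)
    have finP: "finite ?P" by (intro finite_permutations) simp
    have neP: "?P \<noteq> {}" by (metis permutes_id mem_Collect_eq empty_iff)
    \<comment> \<open>Exponential Markov inequality in counting form: on the event every exponential
      is at least 1.\<close>
    have "real (card (?P \<inter> ?E)) = (\<Sum>p\<in>?P \<inter> ?E. 1)" by simp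
    also have "\<dots> \<le> (\<Sum>p\<in>?P \<inter> ?E. exp (x * U_perm n G H id id p - x * t))"
      using x by (intro sum_mono) auto
    also have "\<dots> \<le> (\<Sum>p\<in>?P. exp (x * U_perm n G H id id p - x * t))"
      using finP by (intro sum_mono2) auto
    also have "\<dots> = (\<Sum>p\<in>?P. exp (x * U_perm n G H id id p)) / exp (x * t)"
      by (simp add: exp_diff sum_divide_distrib)
    also have "\<dots> \<le> fact n * exp (12800 * x\<^sup>2 * s\<^sup>2) / exp (x * t)"
      using sum_exp_U_perm_le[of n G H, OF n G H Sigma_n_ge[where G = G and H = H, OF n, folded s_def] x(2)]
      by (intro divide_right_mono) auto
    finally have "real (card (?P \<inter> ?E)) / fact n \<le>
        exp (12800 * x\<^sup>2 * s\<^sup>2 - x * t)"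
      by (simp add: exp_diff field_simps)
    thus ?thesis unfolding measure_pmf_of_set[OF neP finP] cardP .
  qed
  show ?thesis
  proof (cases "s = 0")
    case True
    \<comment> \<open>Here \<open>x\<close> is unconstrained, and \<open>x \<rightarrow> \<infinity>\<close> gives probability 0.\<close>
    have "?pr \<le> 0"
    proof (rule ccontr)
      assume "\<not> ?pr \<le> 0"
      hence pos: "?pr > 0" by simp
      \<comment> \<open>This makes \<open>exp (- (x * t))\<close> at most the supposed positive
        probability divided by e; the maximum with 1 keeps \<open>x\<close> positive.\<close>
      define x where "x = max 1 ((1 - ln ?pr) / t)"
      have x: "x > 0" "x * t \<ge> 1 - ln ?pr"
      proof -
        show "x > 0" by (simp add: x_def)
        have "(1 - ln ?pr) / t * t \<le> x * t" using t by (intro mult_right_mono) (simp_all add: x_def)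
        thus "x * t \<ge> 1 - ln ?pr" using t by simp
      qed
      have "?pr \<le> exp (- (x * t))" using bound[OF x(1)] True by simp
      also have "\<dots> \<le> exp (ln ?pr - 1)" using x by simp
      also have "\<dots> < exp (ln ?pr)" by simp
      also have "\<dots> = ?pr" using pos by simp
      finally show False by simp
    qed
    thus ?thesis using True by (simp add: exp_tail_def s_def)
  next
    case False
    have "s \<ge> 0" unfolding s_def by (rule Sigma_n_nonneg)
    hence s: "s > 0" using False by simp
    define u where "u = min (t\<^sup>2 / s\<^sup>2) (t / s)"
    \<comment> \<open>Both constraints on \<open>x\<close> hold: \<open>x s\<close> is small, and the quadratic term is at most \<open>x t / 2\<close>.\<close>
    define x where "x = u / (25600 * t)"
    \<comment> \<open>The bound by \<open>t / s\<close> will make \<open>x * s\<close> small, the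
      other one will control the quadratic term.\<close>
    have u: "u > 0" "u \<le> t\<^sup>2 / s\<^sup>2" "u \<le> t / s" using s t by (auto simp: u_def)
    have x0: "x > 0" using u t by (simp add: x_def)
    have xs: "x * s \<le> 1 / 25600"
      using u(3) s t by (simp add: x_def field_simps)
    have "(x * s)\<^sup>2 \<le> (1 / 25600)\<^sup>2" using xs x0 s by (intro power_mono) auto
    hence cond: "6400 * x\<^sup>2 * s\<^sup>2 \<le> 1/25" by (simp add: power_mult_distrib power_divide)
    have "x * s\<^sup>2 \<le> t / 25600"
      using u(2) s t by (simp add: x_def field_simps power2_eq_square)
    hence "x * (x * s\<^sup>2) \<le> x * (t / 25600)" using x0 by (intro mult_left_mono) auto
    hence "12800 * x\<^sup>2 * s\<^sup>2 - x * t \<le> - (x * t / 2)" by (simp add: power2_eq_square)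
    also have "x * t / 2 = u / 51200" using t by (simp add: x_def)
    finally have "?pr \<le> exp (- (u / 51200))"
      using bound[OF x0 cond] by (meson exp_le_cancel_iff order_trans)
    thus ?thesis using False by (simp add: exp_tail_def s_def u_def)
  qed
qed

text \<open>Pulling the kernels back along the sample, \<open>(i, j) \<mapsto> gY (Y i) (Y j)\<close>, replaces it by the
  indices themselves.\<close>

lemma perm_tail_bound_of_index_kernels:
  "perm_tail_bound TYPE('a) TYPE('b) C"
  if "\<And>n G H t. n \<ge> 4 \<Longrightarrow> (\<And>i j. G i j = G j i) \<Longrightarrow> (\<And>i j. H i j = H j i) \<Longrightarrow> t > 0 \<Longrightarrow>
    measure_pmf.prob (pmf_of_set {p. p permutes {1..n}}) {p. U_perm n G H id id p \<ge> t} \<le>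
      exp_tail C (Sigma_n n G H id id) t"
  unfolding perm_tail_bound_def
proof (intro allI impI)
  fix n :: nat and gY :: "'a \<Rightarrow> 'a \<Rightarrow> real" and gZ :: "'b \<Rightarrow> 'b \<Rightarrow> real"
    and Y :: "nat \<Rightarrow> 'a" and Z :: "nat \<Rightarrow> 'b" and t :: real
  assume n: "4 \<le> n" and gY: "\<forall>y1 y2. gY y1 y2 = gY y2 y1"
    and gZ: "\<forall>z1 z2. gZ z1 z2 = gZ z2 z1" and t: "0 < t"
  define G where "G = (\<lambda>i j. gY (Y i) (Y j))"
  define H where "H = (\<lambda>i j. gZ (Z i) (Z j))"
  have "U_perm n gY gZ Y Z = U_perm n G H id id" "Sigma_n n gY gZ Y Z = Sigma_n n G H id id"
    by (simp_all add: fun_eq_iff U_perm_def Sigma_n_def h_in_def G_def H_def)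
  thus "measure_pmf.prob (pmf_of_set {p. p permutes {1..n}}) {p. U_perm n gY gZ Y Z p \<ge> t} \<le>
      exp_tail C (Sigma_n n gY gZ Y Z) t"
  proof (simp only:, intro that n t)
    show "G i j = G j i" "H i j = H j i" for i j
      unfolding G_def H_def using gY gZ by blast+
  qed
qed

theorem theorem6p2:
  "(\<exists>C>0. perm_tail_bound TYPE('a) TYPE('b) C) \<and>
   (\<forall>C>0. perm_tail_bound TYPE(nat) TYPE(nat) C \<longrightarrow> perm_tail_bound TYPE('a) TYPE('b) C)"
proof (intro conjI allI impI)
  show "\<exists>C>0. perm_tail_bound TYPE('a) TYPE('b) C"
  proof (intro exI conjI)
    show "(0::real) < 1/51200" by simp
    show "perm_tail_bound TYPE('a) TYPE('b) (1/51200)"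
      by (rule perm_tail_bound_of_index_kernels)
        (rule prob_U_perm_ge_le, assumption+)
  qed
next
  fix C :: real
  assume nat: "perm_tail_bound TYPE(nat) TYPE(nat) C"
  \<comment> \<open>Index kernels with identity samples are an instance of the bound for
    \<open>nat\<close>, so the reduction passes any such \<open>C\<close> on to \<open>'a\<close>
    and \<open>'b\<close>.\<close>
  show "perm_tail_bound TYPE('a) TYPE('b) C"
    by (rule perm_tail_bound_of_index_kernels)
      (rule nat[unfolded perm_tail_bound_def, rule_format], assumption+)
qed

end
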